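(* Let $d\in\mathbb N$, let $T_e=\sum_{i=1}^d e_i^{\otimes 3}\in\mathrm{Sym}^3(\mathbb R^d)$, let $\|\cdot\|$ be any norm on $\mathrm{Sym}^3(\mathbb R^d)$, and define $\mathcal L:M(d,d)\to\mathbb R$ by $\mathcal L(W)=\big\|\sum_{i=1}^d w_i^{\otimes 3}-T_e\big\|^2$, where $w_1,\dots,w_d$ are the rows of $W$. Then $W\in M(d,d)$ is a global minimizer of $\mathcal L$ if and only if $W\in(S_d\times S_d)I_d$, the orbit of the identity matrix, i.e. the set of all $d\times d$ permutation matrices. In particular, the set of global minimizers of $\mathcal L$ coincides with the set of $W\in M(d,d)$ defining valid decompositions of $T_e$, i.e. satisfying $T_e=\sum_{i=1}^d w_i^{\otimes 3}$.
   Context: $M(d,d)$ is the space of real $d\times d$ matrices, $e_i$ is the $i$-th unit vector of $\mathbb R^d$, and $\mathrm{Sym}^3(\mathbb R^d)$ is the space of symmetric order-$3$ tensors on $\mathbb R^d$. The group $S_d\times S_d$ acts on $M(d,d)$ by $((\sigma_1,\sigma_2)A)_{ij}=A_{\sigma_1^{-1}(i),\sigma_2^{-1}(j)}$ (the first factor permutes rows, the second columns). *)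

theory Defs
  imports "HOL-Analysis.Analysis"
begin

text \<open>
  Order-3 tensors on $R^d$ are coordinate arrays \<open>real^'d^'d^'d\<close>, where \<open>'d\<close> is a finite index
  type with \<open>d = CARD('d)\<close>.
\<close>

definition Sym3 :: "(real^'d^'d^'d) set" where
  "Sym3 = {T. \<forall>i j k. T$i$j$k = T$i$k$j \<and> T$i$j$k = T$j$i$k \<and> T$i$j$k = T$j$k$i
                     \<and> T$i$j$k = T$k$i$j \<and> T$i$j$k = T$k$j$i}"

definition tensor_cube :: "real^'d \<Rightarrow> real^'d^'d^'d" where
  "tensor_cube v = (\<chi> i j k. v$i * v$j * v$k)"

definition unit_tensor :: "real^'d^'d^'d" where
  "unit_tensor = (\<Sum>i\<in>UNIV. tensor_cube (axis i 1))"

text \<open>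
  A norm on a linear subspace \<open>S\<close>, given by a function on the ambient space whose values
  outside \<open>S\<close> are irrelevant.
\<close>

definition norm_on :: "'a::real_vector set \<Rightarrow> ('a \<Rightarrow> real) \<Rightarrow> bool" where
  "norm_on S N \<longleftrightarrow>
     (\<forall>x\<in>S. 0 \<le> N x) \<and>
     (\<forall>x\<in>S. N x = 0 \<longleftrightarrow> x = 0) \<and>
     (\<forall>c. \<forall>x\<in>S. N (c *\<^sub>R x) = \<bar>c\<bar> * N x) \<and>
     (\<forall>x\<in>S. \<forall>y\<in>S. N (x + y) \<le> N x + N y)"

definition loss :: "(real^'d^'d^'d \<Rightarrow> real) \<Rightarrow> real^'d^'d \<Rightarrow> real" where
  "loss N W = (N ((\<Sum>i\<in>UNIV. tensor_cube (row i W)) - unit_tensor))\<^sup>2"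

definition perm_act :: "('d \<Rightarrow> 'd) \<times> ('d \<Rightarrow> 'd) \<Rightarrow> real^'d^'d \<Rightarrow> real^'d^'d" where
  "perm_act p A = (\<chi> i j. A $ (inv (fst p) i) $ (inv (snd p) j))"

definition perm_orbit :: "real^'d^'d \<Rightarrow> (real^'d^'d) set" where
  "perm_orbit A = {perm_act (\<sigma>, \<tau>) A |\<sigma> \<tau>. \<sigma> permutes UNIV \<and> \<tau> permutes UNIV}"

definition permutation_matrix :: "real^'d^'d \<Rightarrow> bool" where
  "permutation_matrix A \<longleftrightarrow>
     (\<forall>i j. A$i$j = 0 \<or> A$i$j = 1) \<and>
     (\<forall>i. \<exists>!j. A$i$j = 1) \<and>
     (\<forall>j. \<exists>!i. A$i$j = 1)"

text \<open>The tensors to which \<open>loss\<close> applies \<open>N\<close> lie in \<open>Sym3\<close>.\<close>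

lemma subspace_Sym3: "subspace (Sym3 :: (real^'d^'d^'d) set)"
  unfolding subspace_def Sym3_def by (auto; metis)

lemma tensor_cube_in_Sym3: "tensor_cube v \<in> Sym3"
  by (simp add: Sym3_def tensor_cube_def mult_ac)

lemma loss_argument_in_Sym3:
  "(\<Sum>i\<in>UNIV. tensor_cube (row i W)) - unit_tensor \<in> Sym3"
  unfolding unit_tensor_def
  by (intro subspace_diff subspace_sum subspace_Sym3 tensor_cube_in_Sym3)

end

theory Submission
  imports Defs
begin

text \<open>
  Let \<open>W\<close> decompose the unit tensor, so that \<open>\<Sum>i. W\<^sub>i\<^sub>j W\<^sub>i\<^sub>k W\<^sub>i\<^sub>l\<close> is \<open>1\<close> if
  \<open>j = k = l\<close> and \<open>0\<close> otherwise. Summing over \<open>l\<close> gives \<open>W\<^sup>T D W = I\<close> with \<open>D\<close> the diagonal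
  matrix of the row sums, so the rows of \<open>W\<close> are linearly independent. For \<open>j \<noteq> k\<close> the numbers
  \<open>W\<^sub>i\<^sub>j W\<^sub>i\<^sub>k\<close> are the coefficients of a vanishing linear combination of the rows, hence all zero:
  each row has at most one nonzero entry. As the cubes in every column sum to \<open>1\<close>, each column
  has a nonzero entry; counting shows that it is unique, and its cube is \<open>1\<close>.
\<close>

text \<open>The loss is nonnegative and vanishes at the identity matrix, so its minimizers are
  exactly its zeros. Definiteness of \<open>N\<close> on \<open>Sym3\<close> turns zero loss into
  the tensor equation.\<close>

lemma is_arg_min_loss_iff:
  assumes "norm_on Sym3 N"
  shows "is_arg_min (loss N) (\<lambda>_. True) W \<longleftrightarrow> unit_tensor = (\<Sum>i\<in>UNIV. tensor_cube (row i W))"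
proof -
  have zero: "loss N V = 0 \<longleftrightarrow> unit_tensor = (\<Sum>i\<in>UNIV. tensor_cube (row i V))" for V
    using assms loss_argument_in_Sym3[of V] by (auto simp: loss_def norm_on_def)
  have "row i (mat 1 :: real^'a^'a) = axis i 1" for i
    by (simp add: vec_eq_iff row_def mat_def axis_def eq_commute)
  then have "loss N (mat 1) = 0"
    unfolding zero unit_tensor_def by simp
  moreover have "loss N V \<ge> 0" for V
    by (simp add: loss_def)
  ultimately show ?thesis
    unfolding zero[symmetric] is_arg_min_def
    by (metis antisym_conv2 not_less)
qed

lemma unit_tensor_nth: "unit_tensor $ j $ k $ l = (if j = k \<and> k = l then 1 else 0)"
proof -
  have "unit_tensor $ j $ k $ l = (\<Sum>i\<in>UNIV. if i = j then (if j = k \<and> k = l then 1 else 0) else (0::real))"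
    unfolding unit_tensor_def tensor_cube_def sum_component
    by (intro sum.cong) (auto simp: axis_def)
  then show ?thesis by simp
qed

lemma permutation_matrix_if_decomposition:
  fixes W :: "real^'d^'d"
  assumes "unit_tensor = (\<Sum>i\<in>UNIV. tensor_cube (row i W))"
  shows "permutation_matrix W"
proof -
  have entry: "(\<Sum>i\<in>UNIV. W$i$j * W$i$k * W$i$l) = (if j = k \<and> k = l then 1 else 0)" for j k l
  proof -
    have "(\<Sum>i\<in>UNIV. tensor_cube (row i W)) $ j $ k $ l = (\<Sum>i\<in>UNIV. W$i$j * W$i$k * W$i$l)"
      by (simp add: tensor_cube_def row_def)
    then show ?thesis
      using unit_tensor_nth[of j k l] assms by simp
  qed
  define B :: "real^'d^'d" where "B = (\<chi> i k. (\<Sum>l\<in>UNIV. W$i$l) * W$i$k)"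
  have "transpose W ** B = mat 1"
  proof -
    have "(transpose W ** B) $ j $ k = mat 1 $ j $ k" for j k
    proof -
      have "(transpose W ** B) $ j $ k = (\<Sum>i\<in>UNIV. \<Sum>l\<in>UNIV. W$i$j * W$i$k * W$i$l)"
        by (simp add: matrix_matrix_mult_def transpose_def B_def sum_distrib_left mult_ac)
      also have "\<dots> = (\<Sum>l\<in>UNIV. \<Sum>i\<in>UNIV. W$i$j * W$i$k * W$i$l)"
        by (rule sum.swap)
      also have "\<dots> = (\<Sum>l\<in>UNIV. if k = l then (if j = k then 1 else 0) else 0)"
        unfolding entry by (auto intro!: sum.cong)
      also have "\<dots> = mat 1 $ j $ k"
        by (simp add: mat_def)
      finally show ?thesis .
    qed
    then show ?thesis by (simp add: vec_eq_iff)
  qed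
  \<comment> \<open>For square matrices a right inverse is also a left inverse, so
    \<open>transpose W\<close> has trivial kernel.\<close>
  then have left_inverse: "B ** transpose W = mat 1"
    by (simp add: matrix_left_right_inverse)
  have row_disjoint: "W$i$j * W$i$k = 0" if "j \<noteq> k" for i j k
  proof -
    define x where "x = (\<chi> i. W$i$j * W$i$k)"
    \<comment> \<open>Coordinate \<open>l\<close> of this product is the sum in \<open>entry\<close>
      for \<open>j\<close>, \<open>k\<close>, \<open>l\<close>, which is zero as
      \<open>j \<noteq> k\<close>.\<close>
    have "transpose W *v x = 0"
      using entry that
      by (simp add: vec_eq_iff matrix_vector_mult_def transpose_def x_def mult_ac)
    then have "x = 0"
      by (metis left_inverse matrix_vector_mul_assoc matrix_vector_mul_lid matrix_vector_mult_0_right)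
    then have "x $ i = 0" by simp
    then show ?thesis by (simp add: x_def)
  qed
  have "\<exists>i. W$i$j \<noteq> 0" for j
  proof (rule ccontr)
    assume "\<nexists>i. W$i$j \<noteq> 0"
    then show False using entry[of j j j] by simp
  qed
  then obtain f where f: "\<And>j. W $ f j $ j \<noteq> 0"
    by metis
  have "inj f"
  proof (rule injI)
    fix j k assume "f j = f k"
    then show "j = k"
      using row_disjoint[of j k "f j"] f[of j] f[of k] by auto
  qed
  then have "bij f"
    by (simp add: bij_def finite_UNIV_inj_surj)
  have off: "W$i$j = 0" if "i \<noteq> f j" for i j
  \<comment> \<open>As \<open>f\<close> is onto, row \<open>i\<close> is \<open>f k\<close> for some
    column \<open>k\<close>, and its nonzero entry there forces zeros in all other columns.\<close>
  proof -
    obtain k where k: "i = f k"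
      using \<open>bij f\<close> by (metis bij_pointE)
    then have "j \<noteq> k" using that by auto
    then show ?thesis
      using row_disjoint[of j k i] f[of k] k by simp
  qed
  have on: "W $ f j $ j = 1" for j
  proof -
    have "(\<Sum>i\<in>UNIV. W$i$j * W$i$j * W$i$j)
        = (\<Sum>i\<in>UNIV. if i = f j then (W $ f j $ j) ^ 3 else 0)"
      using off by (intro sum.cong) (auto simp: power3_eq_cube)
    then have "(W $ f j $ j) ^ 3 = 1 ^ 3"
      using entry[of j j j] by simp
    then show ?thesis
      using odd_real_root_unique[of 3 "W $ f j $ j" 1] by simp
  qed
  have one_iff: "W$i$j = 1 \<longleftrightarrow> i = f j" for i j
    using on off by (metis zero_neq_one)
  have "W$i$j = 0 \<or> W$i$j = 1" for i j
    using on off by metis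
  moreover have "\<exists>!j. i = f j" for i
    using \<open>bij f\<close> unfolding bij_iff by metis
  ultimately show ?thesis
    unfolding permutation_matrix_def by (simp add: one_iff)
qed

text \<open>Permuting columns alone suffices: \<open>f\<close> sends each row to the column of its
  1, and the row permutation is \<open>id\<close>.\<close>

lemma permutation_matrix_in_perm_orbit:
  fixes W :: "real^'d^'d"
  assumes "permutation_matrix W"
  shows "W \<in> perm_orbit (mat 1)"
proof -
  obtain f where f: "\<And>i j. W$i$j = 1 \<longleftrightarrow> j = f i"
    using assms unfolding permutation_matrix_def by metis
  have "bij f"
    using assms f unfolding permutation_matrix_def bij_iff by metis
  have "W = perm_act (id, f) (mat 1)"
  proof -
    have "W$i$j = perm_act (id, f) (mat 1) $ i $ j" for i j
    proof -
      have "inv f j = i \<longleftrightarrow> W$i$j = 1"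
        using \<open>bij f\<close> f by (metis bij_inv_eq_iff)
      then show ?thesis
        using assms unfolding permutation_matrix_def
        by (auto simp: perm_act_def mat_def)
    qed
    then show ?thesis by (simp add: vec_eq_iff)
  qed
  moreover have "f permutes UNIV" "id permutes (UNIV :: 'd set)"
    using \<open>bij f\<close> by (simp_all add: permutes_def bij_iff)
  ultimately show ?thesis
    unfolding perm_orbit_def by blast
qed

text \<open>The rows are the unit vectors in an order given by
  \<open>\<tau> \<circ> inv \<sigma>\<close>, so the sum of cubes is merely reindexed.\<close>

lemma decomposition_if_in_perm_orbit:
  fixes W :: "real^'d^'d"
  assumes "W \<in> perm_orbit (mat 1)"
  shows "unit_tensor = (\<Sum>i\<in>UNIV. tensor_cube (row i W))"
proof -
  obtain \<sigma> \<tau> where W: "W = perm_act (\<sigma>, \<tau>) (mat 1)"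
    and \<sigma>: "\<sigma> permutes UNIV" and \<tau>: "\<tau> permutes UNIV"
    using assms unfolding perm_orbit_def by blast
  have "inv \<tau> j = inv \<sigma> i \<longleftrightarrow> j = (\<tau> \<circ> inv \<sigma>) i" for i j
    using \<tau> by (metis comp_apply permutes_inverses)
  then have "row i W = axis ((\<tau> \<circ> inv \<sigma>) i) 1" for i
    unfolding W
    by (auto simp: vec_eq_iff row_def perm_act_def mat_def axis_def eq_commute)
  then have "(\<Sum>i\<in>UNIV. tensor_cube (row i W))
      = (\<Sum>i\<in>UNIV. tensor_cube (axis ((\<tau> \<circ> inv \<sigma>) i) 1))"
    by simp
  also have "\<dots> = unit_tensor"
    unfolding unit_tensor_def
    by (rule sum.reindex_bij_betw)
      (intro permutes_imp_bij permutes_compose permutes_inv \<sigma> \<tau>)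
  finally show ?thesis ..
qed

text \<open>The direction from the orbit to permutation matrices passes through the decomposition of
  \<open>unit_tensor\<close>.\<close>

lemma permutation_matrix_iff_in_perm_orbit:
  "permutation_matrix W \<longleftrightarrow> W \<in> perm_orbit (mat 1)"
  using permutation_matrix_if_decomposition permutation_matrix_in_perm_orbit
    decomposition_if_in_perm_orbit by blast

theorem proposition1:
  fixes N :: "real^'d^'d^'d \<Rightarrow> real"
  assumes "norm_on Sym3 N"
  shows "(\<forall>W :: real^'d^'d. is_arg_min (loss N) (\<lambda>_. True) W \<longleftrightarrow> W \<in> perm_orbit (mat 1))
       \<and> perm_orbit (mat 1 :: real^'d^'d) = {W. permutation_matrix W}
       \<and> {W :: real^'d^'d. is_arg_min (loss N) (\<lambda>_. True) W}
           = {W. unit_tensor = (\<Sum>i\<in>UNIV. tensor_cube (row i W))}"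
  using is_arg_min_loss_iff[OF assms] permutation_matrix_if_decomposition
    permutation_matrix_iff_in_perm_orbit decomposition_if_in_perm_orbit
  by blast

end
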